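(* Let $p$ be an odd prime with $p \equiv 2 \pmod 3$, and let $c$ be an integer with $1 \le c \le p-1$. Let $M_{p-1} = [m_{ij}]_{1 \le i,j \le p-1}$ be the $(p-1) \times (p-1)$ matrix with entries $m_{ij} = \left[ \frac{j-i+c}{p} \right]$. Then $\det(M_{p-1}) = 1$.
   Context: For an odd prime $p$ and an integer $a$, the cubic residue symbol is defined by $\left[ \frac{a}{p} \right] = 1$ if $a \not\equiv 0 \pmod p$ and $x^3 \equiv a \pmod p$ has an integer solution; $\left[ \frac{a}{p} \right] = -1$ if $x^3 \equiv a \pmod p$ has no integer solution; and $\left[ \frac{a}{p} \right] = 0$ if $a \equiv 0 \pmod p$. *)

theory Defs
  imports
    "Jordan_Normal_Form.Determinant"
    "HOL-Computational_Algebra.Primes"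
    "HOL-Number_Theory.Cong"
begin

text \<open>The cubic residue symbol $[a/p]$. The case \<open>a \<equiv> 0\<close> has to be singled out, since
  \<open>x ^ 3 \<equiv> a\<close> is then solvable by \<open>x = 0\<close>. The definition is meant for odd primes \<open>p\<close>.\<close>

definition cubic_residue_symbol :: "int \<Rightarrow> nat \<Rightarrow> int" where
  "cubic_residue_symbol a p =
    (if [a = 0] (mod int p) then 0
     else if \<exists>x::int. [x ^ 3 = a] (mod int p) then 1
     else -1)"

text \<open>Matrices of type \<^typ>\<open>int mat\<close> are indexed from \<open>0\<close>, so that position \<open>(i, j)\<close> carries
  the entry with mathematical indices \<open>(i + 1, j + 1)\<close>.\<close>

definition cubic_residue_mat :: "nat \<Rightarrow> int \<Rightarrow> int mat" where
  "cubic_residue_mat p c =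
    mat (p - 1) (p - 1)
      (\<lambda>(i, j). cubic_residue_symbol (int (j + 1) - int (i + 1) + c) p)"

end

theory Submission
  imports Defs "HOL-Number_Theory.Residues"
begin

text \<open>Cubing is a bijection modulo \<open>p\<close>, so the symbol is the indicator of nonzero residues, and
  the matrix is the all-ones matrix minus a partial permutation matrix whose row \<open>c\<close> is zero.
  Subtracting the all-ones row from the other rows leaves, up to signs, a matrix with a single
  contributing permutation, namely the cycle \<open>x \<mapsto> x - c\<close> of \<open>\<int>/p\<int>\<close> with \<open>0\<close> bypassed. It is the
  composition of a translation, which is a square because \<open>p\<close> is odd, and a transposition; hence
  it is odd.\<close>

text \<open>For \<open>p = 3 * k + 2\<close> the cube root of \<open>a\<close> is its power with
  exponent \<open>2 * k + 1\<close>: three times this exponent is \<open>2 * (p - 1) + 1\<close>,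
  and Fermat's little theorem removes the multiple of \<open>p - 1\<close>.\<close>

lemma cong_cube_solvable:
  fixes p :: nat and a :: int
  assumes p: "prime p" "[p = 2] (mod 3)" and a: "\<not> [a = 0] (mod int p)"
  shows "\<exists>x::int. [x ^ 3 = a] (mod int p)"
proof -
  define b where "b = nat (a mod int p)"
  have p0: "p > 0" using p(1) by (rule prime_gt_0_nat)
  have b: "int b = a mod int p" using p0 by (simp add: b_def)
  have "\<not> p dvd b"
  proof
    assume "p dvd b"
    then have "int p dvd a mod int p" using b by (metis of_nat_dvd_iff)
    then show False using a by (simp add: cong_0_iff dvd_mod_iff)
  qed
  then have f: "[b ^ (p - 1) = 1] (mod p)" using p(1) by (rule fermat_theorem[rotated])
  have "p mod 3 = 2" using p(2) by (simp add: cong_def)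
  then obtain k where k: "p = 3 * k + 2" by (metis mult_div_mod_eq)
  have "(b ^ (2 * k + 1)) ^ 3 = (b ^ (p - 1)) ^ 2 * b"
  proof -
    have "(2 * k + 1) * 3 = (p - 1) * 2 + 1" using k by simp
    then show ?thesis by (metis power_mult power_add power_one_right)
  qed
  also have "[\<dots> = 1 ^ 2 * b] (mod p)"
    using f by (intro cong_mult cong_pow cong_refl)
  finally have "[int ((b ^ (2 * k + 1)) ^ 3) = int b] (mod int p)"
    by (simp only: cong_int_iff power_one mult_1)
  then have "[int (b ^ (2 * k + 1)) ^ 3 = a] (mod int p)"
    unfolding b by (simp add: cong_def)
  then show ?thesis by blast
qed

lemma cubic_residue_symbol_eq:
  assumes "prime p" "[p = 2] (mod 3)"
  shows "cubic_residue_symbol a p = (if int p dvd a then 0 else 1)"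
  using cong_cube_solvable[OF assms, of a] by (auto simp: cubic_residue_symbol_def cong_0_iff)

text \<open>Injectivity forces the value at \<open>k\<close>: the preimage of
  \<open>\<sigma> k\<close> under \<open>\<pi>\<close> can only be \<open>k\<close>.\<close>

lemma permutes_eqI_except:
  assumes \<pi>: "\<pi> permutes S" and \<sigma>: "\<sigma> permutes S"
    and eq: "\<And>i. i \<in> S \<Longrightarrow> i \<noteq> k \<Longrightarrow> \<pi> i = \<sigma> i"
  shows "\<pi> = \<sigma>"
proof
  have off: "\<pi> i = \<sigma> i" if "i \<noteq> k" for i
    using that eq permutes_not_in[OF \<pi>] permutes_not_in[OF \<sigma>] by metis
  fix i
  show "\<pi> i = \<sigma> i"
  proof (cases "i = k")
    case True
    obtain j where j: "\<pi> j = \<sigma> k" using permutes_surj[OF \<pi>] by (metis surjD)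
    have "j = k"
      using off[of j] j permutes_inj[OF \<sigma>] by (metis injD)
    with j True show ?thesis by simp
  qed (rule off)
qed

text \<open>A nonzero term of the Leibniz expansion agrees with \<open>\<sigma>\<close> in every row
  but \<open>k\<close>, hence in row \<open>k\<close> as well, whatever that row contains.\<close>

lemma det_permutation_except_row:
  fixes A :: "'a :: comm_ring_1 mat"
  assumes A: "A \<in> carrier_mat n n" and \<sigma>: "\<sigma> permutes {0..<n}"
    and zero: "\<And>i j. i < n \<Longrightarrow> j < n \<Longrightarrow> i \<noteq> k \<Longrightarrow> j \<noteq> \<sigma> i \<Longrightarrow> A $$ (i, j) = 0"
  shows "det A = signof \<sigma> * (\<Prod>i = 0..<n. A $$ (i, \<sigma> i))"
proof -
  have "(\<Prod>i = 0..<n. A $$ (i, \<pi> i)) = 0" if \<pi>: "\<pi> permutes {0..<n}" "\<pi> \<noteq> \<sigma>" for \<pi>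
  proof -
    obtain i where i: "i \<in> {0..<n}" "i \<noteq> k" "\<pi> i \<noteq> \<sigma> i"
      using permutes_eqI_except[OF \<pi>(1) \<sigma>] \<pi>(2) by blast
    moreover have "\<pi> i \<in> {0..<n}" using i(1) \<pi>(1) by (simp only: permutes_in_image)
    ultimately have "A $$ (i, \<pi> i) = 0" by (intro zero) auto
    with i(1) show ?thesis by (intro prod_zero) auto
  qed
  then have "det A = (\<Sum>\<pi>\<in>{\<pi>. \<pi> permutes {0..<n}}.
      if \<pi> = \<sigma> then signof \<sigma> * (\<Prod>i = 0..<n. A $$ (i, \<sigma> i)) else 0)"
    unfolding det_def'[OF A] by (intro sum.cong) auto
  also have "\<dots> = signof \<sigma> * (\<Prod>i = 0..<n. A $$ (i, \<sigma> i))"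
    using \<sigma> by (subst sum.delta) (auto simp: finite_permutations)
  finally show ?thesis .
qed

lemma det_ones_minus_permutation_except_row:
  fixes \<sigma> :: "nat \<Rightarrow> nat"
  assumes \<sigma>: "\<sigma> permutes {0..<n}" and k: "k < n"
  shows "det (mat n n (\<lambda>(i, j). if i \<noteq> k \<and> j = \<sigma> i then 0 else 1 :: 'a :: comm_ring_1))
    = (-1) ^ (n - 1) * signof \<sigma>"
proof -
  \<comment> \<open>\<open>T\<close> is the permutation matrix of \<open>\<sigma>\<close> with row
    \<open>k\<close> replaced by ones; left multiplication by \<open>L\<close> keeps row
    \<open>k\<close> and turns every other row into row \<open>k\<close> minus itself.\<close>
  define L :: "'a mat" where
    "L = mat n n (\<lambda>(i, j). if j = k then 1 else if i = j then -1 else 0)"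
  define T :: "'a mat" where
    "T = mat n n (\<lambda>(i, j). if i = k \<or> j = \<sigma> i then 1 else 0)"
  have car: "L \<in> carrier_mat n n" "T \<in> carrier_mat n n" by (simp_all add: L_def T_def)
  have eq: "mat n n (\<lambda>(i, j). if i \<noteq> k \<and> j = \<sigma> i then 0 else 1) = L * T"
  proof (rule eq_matI)
    fix i j assume "i < dim_row (L * T)" "j < dim_col (L * T)"
    then have ij: "i < n" "j < n" using car by auto
    have "(L * T) $$ (i, j) = (\<Sum>m = 0..<n. L $$ (i, m) * T $$ (m, j))"
      using ij car by (simp add: scalar_prod_def)
    \<comment> \<open>Row \<open>i\<close> of \<open>L\<close> is supported on the columns
      \<open>k\<close> and \<open>i\<close>. These coincide for \<open>i = k\<close>, so the second
      summand must vanish there.\<close>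
    also have "\<dots> = (\<Sum>m = 0..<n. (if m = k then 1 else 0)
        + (if m = i then if i = k \<or> j \<noteq> \<sigma> i then 0 else -1 else 0))"
      using ij by (intro sum.cong) (auto simp: L_def T_def)
    also have "\<dots> = (if i \<noteq> k \<and> j = \<sigma> i then 0 else 1)"
      using ij k by (simp add: sum.distrib)
    finally show "mat n n (\<lambda>(i, j). if i \<noteq> k \<and> j = \<sigma> i then 0 else 1) $$ (i, j) = (L * T) $$ (i, j)"
      using ij by simp
  qed (use car in auto)
  \<comment> \<open>Transposing moves the full column \<open>k\<close> into row \<open>k\<close>,
    leaving a diagonal matrix outside that row.\<close>
  have "det L = det (transpose_mat L)" using car by (simp add: det_transpose)
  also have "\<dots> = (\<Prod>i = 0..<n. L $$ (i, i))"
    using car by (subst det_permutation_except_row[where \<sigma> = id and k = k and n = n])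
      (auto simp: L_def permutes_id)
  also have "\<dots> = (\<Prod>i\<in>{0..<n} - {k}. -1)"
    using k by (subst prod.remove[of _ k]) (auto simp: L_def intro!: prod.cong)
  also have "\<dots> = (-1) ^ (n - 1)" using k by simp
  finally have detL: "det L = (-1) ^ (n - 1)" .
  have "\<sigma> i < n" if "i < n" for i using that permutes_in_image[OF \<sigma>, of i] by simp
  then have "(\<Prod>i = 0..<n. T $$ (i, \<sigma> i)) = 1" by (intro prod.neutral) (auto simp: T_def)
  then have "det T = signof \<sigma>"
    using det_permutation_except_row[OF car(2) \<sigma>, of k] by (auto simp: T_def)
  with detL show ?thesis unfolding eq det_mult[OF car] by simp
qed

definition translation :: "nat \<Rightarrow> nat \<Rightarrow> nat \<Rightarrow> nat" where
  "translation n s i = (if i < n then (i + s) mod n else i)"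

lemma translation_comp: "translation n s \<circ> translation n t = translation n (t + s)"
proof
  fix i
  have "((i + t) mod n + s) mod n = (i + (t + s)) mod n"
    by (simp only: mod_add_left_eq add.assoc)
  then show "(translation n s \<circ> translation n t) i = translation n (t + s) i"
    by (cases "i < n") (simp_all add: translation_def)
qed

lemma translation_multiple: "translation n (n * q) = id"
  by (rule ext) (simp add: translation_def)

lemma translation_permutes: "translation n s permutes {0..<n}"
proof (cases n)
  case 0
  then have "translation n s = id" by (simp add: translation_def fun_eq_iff)
  then show ?thesis by (simp add: permutes_id)
next
  case (Suc m)
  \<comment> \<open>Shifting by \<open>(n - 1) * s\<close> inverts shifting by \<open>s\<close>,
    also when \<open>s\<close> exceeds \<open>n\<close>.\<close>
  have "m * s + s = n * s" "s + m * s = n * s" using Suc by simp_all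
  then have "translation n s \<circ> translation n (m * s) = id"
       "translation n (m * s) \<circ> translation n s = id"
    by (simp_all only: translation_comp translation_multiple)
  then have "bij (translation n s)" by (metis o_bij)
  then show ?thesis
    unfolding permutes_def bij_iff by (simp add: translation_def)
qed

lemma sign_translation:
  assumes "odd n"
  shows "sign (translation n s) = 1"
proof -
  \<comment> \<open>For odd \<open>n\<close>, \<open>(n + 1) div 2\<close> is the inverse of 2
    modulo \<open>n\<close>, so \<open>h\<close> shifts by half of \<open>s\<close>.\<close>
  define h where "h = translation n (s * ((n + 1) div 2))"
  have perm: "permutation h" unfolding h_def
    by (rule permutes_imp_permutation[OF _ translation_permutes]) simp
  have "s * ((n + 1) div 2) + s * ((n + 1) div 2) = s + n * s"
    using assms by (auto elim!: oddE simp: algebra_simps)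
  then have "h \<circ> h = translation n (n * s) \<circ> translation n s"
    unfolding h_def translation_comp by (rule arg_cong)
  then have "h \<circ> h = translation n s" by (simp add: translation_multiple)
  then show ?thesis using sign_compose[OF perm perm] by (metis sign_idempotent)
qed

theorem theorem3p9:
  fixes p :: nat and c :: int
  assumes "prime p" and "odd p" and "[p = 2] (mod 3)"
    and "1 \<le> c" and "c \<le> int p - 1"
  shows "det (cubic_residue_mat p c) = 1"
proof -
  define d where "d = nat c"
  have c: "c = int d" and d: "1 \<le> d" "d < p" using assms(4,5) by (auto simp: d_def)
  define \<tau> where "\<tau> = translation p (p - d)"
  \<comment> \<open>Index \<open>i\<close> stands for the residue \<open>i + 1\<close>, so \<open>p - 1\<close> is the bypassed residue \<open>0\<close>.\<close>
  define \<sigma> where "\<sigma> = \<tau> \<circ> transpose (d - 1) (p - 1)"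
  have \<tau>: "\<tau> permutes {0..<p}" unfolding \<tau>_def by (rule translation_permutes)
  have \<tau>_val: "\<tau> i = (if i \<ge> d then i - d else i + p - d)" if "i < p" for i
  proof (cases "i \<ge> d")
    case True
    then have "i + (p - d) = i - d + p" using d by simp
    then have "(i + (p - d)) mod p = i - d"
      using that by (metis less_imp_diff_less mod_add_self2 mod_less)
    then show ?thesis using that True by (simp only: \<tau>_def translation_def if_True)
  qed (use that d in \<open>simp add: \<tau>_def translation_def\<close>)
  have "\<sigma> permutes {0..<p}" unfolding \<sigma>_def
    using d by (intro permutes_compose permutes_swap_id \<tau>) auto
  \<comment> \<open>The transposition sends \<open>p - 1\<close> to \<open>d - 1\<close>, which
    \<open>\<tau>\<close> sends back to \<open>p - 1\<close>.\<close>
  moreover have "\<sigma> i = i" if "i \<in> {0..<p} - {0..<p - 1}" for i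
  proof -
    have "i = p - 1" using that by auto
    then show ?thesis using d by (simp add: \<sigma>_def \<tau>_val)
  qed
  ultimately have \<sigma>: "\<sigma> permutes {0..<p - 1}" by (rule permutes_superset)
  have "permutation \<tau>" by (rule permutes_imp_permutation[OF _ \<tau>]) simp
  then have sign: "sign \<sigma> = -1" unfolding \<sigma>_def \<tau>_def using d assms(2)
    by (simp add: sign_compose permutation_swap_id sign_translation sign_swap_id)
  have "cubic_residue_mat p c
      = mat (p - 1) (p - 1) (\<lambda>(i, j). if i \<noteq> d - 1 \<and> j = \<sigma> i then 0 else 1)"
    unfolding cubic_residue_mat_def
  proof (rule cong_mat)
    fix i j assume ij: "i < p - 1" "j < p - 1"
    \<comment> \<open>The left-hand number lies strictly between \<open>-p\<close> and
      \<open>2 * p\<close>, so 0 and \<open>p\<close> are the only multiples it can equal.\<close>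
    have "int p dvd int j - int i + int d \<longleftrightarrow> j + d = i \<or> j + d = i + p"
    proof
      assume "int p dvd int j - int i + int d"
      then obtain q where q: "int j - int i + int d = int p * q" by (rule dvdE)
      have "int p * (-1) < int p * q" "int p * q < int p * 2"
        using ij d unfolding q[symmetric] by auto
      then have "-1 < q" "q < 2" using d by (simp_all only: mult_less_cancel_left_pos of_nat_0_less_iff)
      then have "q = 0 \<or> q = 1" by auto
      then show "j + d = i \<or> j + d = i + p" using q by auto
    next
      assume "j + d = i \<or> j + d = i + p"
      then have "int j - int i + int d = 0 \<or> int j - int i + int d = int p" by auto
      then show "int p dvd int j - int i + int d" by auto
    qed
    also have "\<dots> \<longleftrightarrow> i \<noteq> d - 1 \<and> j = \<sigma> i"
    \<comment> \<open>In row \<open>d - 1\<close> a zero entry would need \<open>j = p - 1\<close>,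
      which is out of range. In every other row the transposition fixes \<open>i\<close>, so
      \<open>\<sigma>\<close> acts as \<open>\<tau>\<close>.\<close>
    proof (cases "i = d - 1")
      case False
      then have "\<sigma> i = (if i \<ge> d then i - d else i + p - d)"
        using ij by (simp add: \<sigma>_def \<tau>_val)
      with False ij d show ?thesis by (auto split: if_splits)
    qed (use ij d in auto)
    finally show "(case (i, j) of (i, j) \<Rightarrow> cubic_residue_symbol (int (j + 1) - int (i + 1) + c) p)
      = (case (i, j) of (i, j) \<Rightarrow> if i \<noteq> d - 1 \<and> j = \<sigma> i then 0 else 1)"
      by (simp add: cubic_residue_symbol_eq[OF assms(1,3)] c)
  qed simp_all
  moreover have k: "d - 1 < p - 1" using d by simp
  ultimately have "det (cubic_residue_mat p c) = (-1) ^ (p - 1 - 1) * signof \<sigma>"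
    using det_ones_minus_permutation_except_row[OF \<sigma>, of "d - 1", where 'a = int] k by simp
  \<comment> \<open>The bounds on \<open>d\<close> give \<open>p\<close> at least 2, so the
    subtraction does not truncate; the odd exponent yields -1, which cancels the sign of
    \<open>\<sigma>\<close>.\<close>
  moreover have "odd (p - 1 - 1)" using assms(2) d by presburger
  ultimately show ?thesis by (simp add: sign)
qed

end
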